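(* Let $q\in(0,1)$ and let $x>-1$ be a real number. Then for every positive integer $n\ge 1$, $$(1+x)_q^n \;\ge\; 1+[n]_q\,x .$$
   Context: For $q\in(0,1)$ and a positive integer $n$, $[n]_q=\frac{q^n-1}{q-1}=1+q+\cdots+q^{n-1}$, and $(1+x)_q^n=\prod_{j=0}^{n-1}(1+q^j x)$. *)

theory Defs
  imports Complex_Main
begin

(* The quotient has the junk value 0 at q = 1; it is only meant for q \<noteq> 1. *)
definition q_number :: "real \<Rightarrow> nat \<Rightarrow> real" where
  "q_number q n = (q ^ n - 1) / (q - 1)"

lemma q_number_eq_sum:
  assumes "q \<noteq> 1"
  shows "q_number q n = (\<Sum>j<n. q ^ j)"
  using assms by (simp add: q_number_def geometric_sum)

(* (1 + x)_q^n is a single symbol for this product, not a power of 1 + x;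
   accordingly the argument here is x, not 1 + x. *)
definition q_binomial_power :: "real \<Rightarrow> real \<Rightarrow> nat \<Rightarrow> real" where
  "q_binomial_power q x n = (\<Prod>j<n. 1 + q ^ j * x)"

end

theory Submission
  imports Defs
begin

text \<open>
  Expanding a product \<open>\<Prod>(1 + c\<^sub>i x)\<close> one factor at a time,
  \<open>(1 + s x) (1 + c x) = 1 + (s + c) x + s c x\<^sup>2\<close>, the excess over the linear part is
  \<open>s c x\<^sup>2\<close>, which is nonnegative for either sign of \<open>x\<close> as long as \<open>s\<close> and \<open>c\<close> are.
  Multiplying an inductive lower bound by the new factor is legitimate because
  \<open>c \<le> 1\<close> and \<open>x \<ge> -1\<close> keep that factor nonnegative. The \<open>q\<close>-Bernoulli inequality is the
  case of the coefficients \<open>c\<^sub>j = q\<^sup>j\<close>, whose sum is the \<open>q\<close>-number.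
\<close>

text \<open>
  A form of the Weierstrass product inequality. Writing all the terms as multiples of a single
  \<open>x\<close> makes them have the same sign, so that no distinction between \<open>x \<ge> 0\<close> and \<open>x < 0\<close>
  is needed.
\<close>

lemma prod_one_plus_mult_ge:
  fixes c :: "'a \<Rightarrow> real" and x :: real
  assumes "finite A" and "\<And>i. i \<in> A \<Longrightarrow> 0 \<le> c i" and "\<And>i. i \<in> A \<Longrightarrow> c i \<le> 1"
    and "x \<ge> -1"
  shows "1 + (\<Sum>i\<in>A. c i) * x \<le> (\<Prod>i\<in>A. 1 + c i * x)"
  using assms(1-3)
proof (induction A rule: finite_induct)
  case empty
  then show ?case by simp
next
  case (insert a A)
  let ?s = "\<Sum>i\<in>A. c i"
  have c: "0 \<le> c a" "c a \<le> 1" and s: "0 \<le> ?s"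
    using insert.prems by (auto intro: sum_nonneg)
  have factor_nonneg: "0 \<le> 1 + c a * x"
    using mult_left_mono[OF \<open>x \<ge> -1\<close> c(1)] c(2) by simp
  have "0 \<le> c a * ?s * x\<^sup>2"
    using c s by simp
  then have "1 + (c a + ?s) * x \<le> (1 + c a * x) * (1 + ?s * x)"
    by (simp add: algebra_simps power2_eq_square)
  also have "\<dots> \<le> (1 + c a * x) * (\<Prod>i\<in>A. 1 + c i * x)"
    using insert factor_nonneg by (intro mult_left_mono) auto
  finally show ?case
    using insert.hyps by simp
qed

theorem theorem1:
  fixes q x :: real and n :: nat
  assumes "0 < q" and "q < 1" and "x > -1" and "n \<ge> 1"
  shows "q_binomial_power q x n \<ge> 1 + q_number q n * x"
proof -
  have "q_number q n = (\<Sum>j<n. q ^ j)"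
    using \<open>q < 1\<close> by (simp add: q_number_eq_sum)
  moreover have "1 + (\<Sum>j<n. q ^ j) * x \<le> (\<Prod>j<n. 1 + q ^ j * x)"
    using assms by (intro prod_one_plus_mult_ge) (auto intro: power_le_one)
  ultimately show ?thesis
    by (simp add: q_binomial_power_def)
qed

end
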